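(* For every integer $n \ge 3$, the lower rank of the semigroup $A^+(B_n)$ is $r_2(A^+(B_n)) = n+3$.
   Context: Brandt semigroup. For $n\ge 1$ let $[n]=\{1,\dots,n\}$ and $B_n = ([n]\times[n])\cup\{\vartheta\}$, with the (non-commutative) operation $+$ given by $(i,j)+(k,l)=(i,l)$ if $j=k$ and $(i,j)+(k,l)=\vartheta$ otherwise, and $\vartheta+x=x+\vartheta=\vartheta$ for all $x\in B_n$. Affine maps. Arguments of functions are written on the left ($xf$ is the value of $f$ at $x$), so $x(fg)=(xf)g$. Let $M(B_n)$ be the set of all maps $B_n\to B_n$, with pointwise addition $+$ and composition. A map is affine if it equals $g+h$ with $g$ an endomorphism of $(B_n,+)$ and $h$ a constant map; $\mathrm{Aff}(B_n)$ is the set of affine maps. $A^+(B_n)$ is the smallest subset of $M(B_n)$ containing $\mathrm{Aff}(B_n)$ and closed under $+$ and composition; here it is regarded as a semigroup under composition only. Explicit description (known). For $c\in B_n$ let $\xi_c$ be the constant map with value $c$; for $k,l,p,q\in[n]$ let ${}^{(k,l)}\zeta_{(p,q)}$ be the map sending $(k,l)$ to $(p,q)$ and all other elements to $\vartheta$; for $p,q\in[n]$ and a permutation $\sigma\in S_n$ let $(p,q;\sigma)$ be the map sending $(i,p)$ to $(i\sigma,q)$ for all $i\in[n]$ and all other elements to $\vartheta$. For $n\ge 2$, $A^+(B_n)=\{(p,q;\sigma): p,q\in[n],\sigma\in S_n\}\cup\{\xi_c : c\in B_n\}\cup\{{}^{(k,l)}\zeta_{(p,q)}: k,l,p,q\in[n]\}$.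 Rank. For a finite semigroup $\Gamma$, the lower rank is $r_2(\Gamma)=\min\{|U| : U\subseteq\Gamma,\ \langle U\rangle=\Gamma\}$, where $\langle U\rangle$ is the subsemigroup generated by $U$. *)

theory Defs
  imports Main "HOL-Library.FuncSet"
begin

datatype brandt = Theta (\<open>\<vartheta>\<close>) | Elt nat nat

definition brandt :: "nat \<Rightarrow> brandt set" where
  "brandt n = insert \<vartheta> {Elt i j | i j. i \<in> {1..n} \<and> j \<in> {1..n}}"

fun brandt_add :: "brandt \<Rightarrow> brandt \<Rightarrow> brandt" (infixl \<open>\<oplus>\<^sub>B\<close> 65) where
  "Elt i j \<oplus>\<^sub>B Elt k l = (if j = k then Elt i l else \<vartheta>)"
| "\<vartheta> \<oplus>\<^sub>B x = \<vartheta>"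
| "x \<oplus>\<^sub>B \<vartheta> = \<vartheta>"

text \<open>Self-maps of \<^term>\<open>brandt n\<close> are represented extensionally (undefined outside
  \<^term>\<open>brandt n\<close>), so that equality of HOL functions is equality of maps.\<close>

definition maps :: "nat \<Rightarrow> (brandt \<Rightarrow> brandt) set" where
  "maps n = brandt n \<rightarrow>\<^sub>E brandt n"

definition fun_add :: "nat \<Rightarrow> (brandt \<Rightarrow> brandt) \<Rightarrow> (brandt \<Rightarrow> brandt) \<Rightarrow> (brandt \<Rightarrow> brandt)" where
  "fun_add n f g = (\<lambda>x\<in>brandt n. f x \<oplus>\<^sub>B g x)"

text \<open>Arguments are written on the left, so the product of \<open>f\<close> and \<open>g\<close> applies \<open>f\<close> first.\<close>

definition fun_comp :: "nat \<Rightarrow> (brandt \<Rightarrow> brandt) \<Rightarrow> (brandt \<Rightarrow> brandt) \<Rightarrow> (brandt \<Rightarrow> brandt)" where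
  "fun_comp n f g = compose (brandt n) g f"

definition const_map :: "nat \<Rightarrow> brandt \<Rightarrow> (brandt \<Rightarrow> brandt)" where
  "const_map n c = (\<lambda>x\<in>brandt n. c)"

definition endomorphisms :: "nat \<Rightarrow> (brandt \<Rightarrow> brandt) set" where
  "endomorphisms n =
    {g \<in> maps n. \<forall>x\<in>brandt n. \<forall>y\<in>brandt n. g (x \<oplus>\<^sub>B y) = g x \<oplus>\<^sub>B g y}"

definition Aff :: "nat \<Rightarrow> (brandt \<Rightarrow> brandt) set" where
  "Aff n = {fun_add n g (const_map n c) | g c. g \<in> endomorphisms n \<and> c \<in> brandt n}"

inductive_set A_plus :: "nat \<Rightarrow> (brandt \<Rightarrow> brandt) set" for n :: nat where
  affine: "f \<in> Aff n \<Longrightarrow> f \<in> A_plus n"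
| add: "f \<in> A_plus n \<Longrightarrow> g \<in> A_plus n \<Longrightarrow> fun_add n f g \<in> A_plus n"
| comp: "f \<in> A_plus n \<Longrightarrow> g \<in> A_plus n \<Longrightarrow> fun_comp n f g \<in> A_plus n"

inductive_set generated :: "('a \<Rightarrow> 'a \<Rightarrow> 'a) \<Rightarrow> 'a set \<Rightarrow> 'a set"
  for mult :: "'a \<Rightarrow> 'a \<Rightarrow> 'a" and U :: "'a set" where
  gen: "x \<in> U \<Longrightarrow> x \<in> generated mult U"
| mult: "x \<in> generated mult U \<Longrightarrow> y \<in> generated mult U \<Longrightarrow> mult x y \<in> generated mult U"

text \<open>Meaningful for a finite semigroup with carrier \<open>S\<close>, where the set below is finite and,
  because \<open>S\<close> generates itself, nonempty.\<close>

definition lower_rank :: "'a set \<Rightarrow> ('a \<Rightarrow> 'a \<Rightarrow> 'a) \<Rightarrow> nat" where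
  "lower_rank S mult = Min {card U | U. U \<subseteq> S \<and> generated mult U = S}"

lemma finite_brandt: "finite (brandt n)"
proof -
  have "brandt n = insert \<vartheta> ((\<lambda>(i, j). Elt i j) ` ({1..n} \<times> {1..n}))"
    by (auto simp: brandt_def)
  then show ?thesis by simp
qed

lemma brandt_iffs:
  "\<vartheta> \<in> brandt n"
  "Elt i j \<in> brandt n \<longleftrightarrow> i \<in> {1..n} \<and> j \<in> {1..n}"
  by (simp_all add: brandt_def)

lemma brandt_add_closed: "x \<in> brandt n \<Longrightarrow> y \<in> brandt n \<Longrightarrow> x \<oplus>\<^sub>B y \<in> brandt n"
  by (cases x; cases y) (simp_all add: brandt_iffs)

lemma brandt_add_assoc: "(x \<oplus>\<^sub>B y) \<oplus>\<^sub>B z = x \<oplus>\<^sub>B (y \<oplus>\<^sub>B z)"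
  by (cases x; cases y; cases z) auto

lemma fun_add_maps: "f \<in> maps n \<Longrightarrow> g \<in> maps n \<Longrightarrow> fun_add n f g \<in> maps n"
  unfolding maps_def fun_add_def by (rule restrict_PiE_iff[THEN iffD2])
    (blast intro: brandt_add_closed dest: PiE_mem)

lemma fun_comp_maps: "f \<in> maps n \<Longrightarrow> g \<in> maps n \<Longrightarrow> fun_comp n f g \<in> maps n"
  unfolding maps_def fun_comp_def compose_def by (rule restrict_PiE_iff[THEN iffD2])
    (blast dest: PiE_mem)

lemma const_map_maps: "c \<in> brandt n \<Longrightarrow> const_map n c \<in> maps n"
  unfolding maps_def const_map_def by (rule restrict_PiE_iff[THEN iffD2]) blast

lemma A_plus_subset_maps: "A_plus n \<subseteq> maps n"
proof
  fix f assume "f \<in> A_plus n"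
  then show "f \<in> maps n"
  proof (induction rule: A_plus.induct)
    case (affine f)
    then obtain g c where "f = fun_add n g (const_map n c)" "g \<in> maps n" "c \<in> brandt n"
      unfolding Aff_def endomorphisms_def by blast
    then show ?case by (simp only: fun_add_maps const_map_maps)
  qed (simp_all only: fun_add_maps fun_comp_maps)
qed

lemma finite_A_plus: "finite (A_plus n)"
  by (rule finite_subset[OF A_plus_subset_maps])
    (simp only: maps_def finite_PiE finite_brandt)

end

theory Submission
  imports Defs "HOL-Combinatorics.Permutations"
begin

text \<open>Besides the constants and the maps supported at a single point, the semigroup consists of the
  column maps \<open>(p,q;\<sigma>)\<close>, which multiply as in a Brandt semigroup over the symmetric group. Column
  maps factor only into column maps; a point map is not a product of column maps and constants, nor a
  nonzero constant one of maps fixing \<open>\<vartheta>\<close>. So one generator of each of these two kinds is needed,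
  and one suffices. The column maps need \<open>n + 1\<close>: with \<open>n\<close> of them the maps \<open>(1,1;\<sigma>)\<close> would
  commute, while a closed circuit through all \<open>n\<close> indices that carries the cyclic permutation,
  together with a transposition at 1, generates everything.\<close>

section \<open>Column maps, point maps and constants\<close>

definition column_map :: "nat \<Rightarrow> nat \<Rightarrow> nat \<Rightarrow> (nat \<Rightarrow> nat) \<Rightarrow> brandt \<Rightarrow> brandt" where
  "column_map n p q \<sigma> =
    (\<lambda>x\<in>brandt n. case x of \<vartheta> \<Rightarrow> \<vartheta> | Elt i j \<Rightarrow> if j = p then Elt (\<sigma> i) q else \<vartheta>)"

text \<open>For nonzero \<open>a\<close> and \<open>b\<close> this is the map zeta of the explicit
  description. The value \<open>b = \<vartheta>\<close> is allowed, since products of point maps can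
  vanish.\<close>

definition point_map :: "nat \<Rightarrow> brandt \<Rightarrow> brandt \<Rightarrow> brandt \<Rightarrow> brandt" where
  "point_map n a b = (\<lambda>x\<in>brandt n. if x = a then b else \<vartheta>)"

definition columns :: "nat \<Rightarrow> (brandt \<Rightarrow> brandt) set" where
  "columns n = {column_map n p q \<sigma> | p q \<sigma>. p \<in> {1..n} \<and> q \<in> {1..n} \<and> \<sigma> permutes {1..n}}"

definition points :: "nat \<Rightarrow> (brandt \<Rightarrow> brandt) set" where
  "points n = {point_map n a b | a b. a \<in> brandt n - {\<vartheta>} \<and> b \<in> brandt n - {\<vartheta>}}"

definition consts_on :: "nat \<Rightarrow> (brandt \<Rightarrow> brandt) set" where
  "consts_on n = const_map n ` brandt n"

lemma columnsI:
  "p \<in> {1..n} \<Longrightarrow> q \<in> {1..n} \<Longrightarrow> \<sigma> permutes {1..n} \<Longrightarrow> column_map n p q \<sigma> \<in> columns n"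
  by (auto simp: columns_def)

lemma pointsI:
  "a \<in> brandt n \<Longrightarrow> a \<noteq> \<vartheta> \<Longrightarrow> b \<in> brandt n \<Longrightarrow> b \<noteq> \<vartheta> \<Longrightarrow> point_map n a b \<in> points n"
  by (auto simp: points_def)

lemma consts_onI: "c \<in> brandt n \<Longrightarrow> const_map n c \<in> consts_on n"
  by (auto simp: consts_on_def)

lemma brandt_nonzeroE:
  assumes "a \<in> brandt n" "a \<noteq> \<vartheta>"
  obtains i j where "a = Elt i j" "i \<in> {1..n}" "j \<in> {1..n}"
  using assms by (auto simp: brandt_def)

lemma brandt_add_zero_right [simp]: "x \<oplus>\<^sub>B \<vartheta> = \<vartheta>"
  by (cases x) auto

text \<open>For \<open>e = Elt a b\<close> the first equation makes \<open>y\<close> the diagonal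
  element at \<open>a\<close>, the second the one at \<open>b\<close>; so \<open>a = b\<close> and
  \<open>e\<close> is that element too.\<close>

lemma brandt_two_sided_unit: "y \<oplus>\<^sub>B e = e \<Longrightarrow> e \<oplus>\<^sub>B y = e \<Longrightarrow> e \<noteq> \<vartheta> \<Longrightarrow> y = e"
  by (cases y; cases e) (auto split: if_splits)

lemma brandt_sandwich: "Elt i i \<oplus>\<^sub>B (y \<oplus>\<^sub>B Elt j j) = y \<Longrightarrow> y \<noteq> \<vartheta> \<Longrightarrow> y = Elt i j"
  by (cases y) (auto split: if_splits)

lemma const_map_apply [simp]: "x \<in> brandt n \<Longrightarrow> const_map n c x = c"
  by (simp add: const_map_def)

lemma column_map_zero [simp]: "column_map n p q \<sigma> \<vartheta> = \<vartheta>"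
  by (simp add: column_map_def brandt_iffs)

lemma column_map_Elt [simp]:
  "i \<in> {1..n} \<Longrightarrow> j \<in> {1..n} \<Longrightarrow>
    column_map n p q \<sigma> (Elt i j) = (if j = p then Elt (\<sigma> i) q else \<vartheta>)"
  by (simp add: column_map_def brandt_iffs)

lemma point_map_apply [simp]:
  "x \<in> brandt n \<Longrightarrow> point_map n a b x = (if x = a then b else \<vartheta>)"
  by (simp add: point_map_def)

lemma fun_comp_apply [simp]: "x \<in> brandt n \<Longrightarrow> fun_comp n f g x = g (f x)"
  by (simp add: fun_comp_def compose_def)

lemma fun_add_apply [simp]: "x \<in> brandt n \<Longrightarrow> fun_add n f g x = f x \<oplus>\<^sub>B g x"
  by (simp add: fun_add_def)

lemma map_eqI:
  assumes "f \<in> extensional (brandt n)" "g \<in> extensional (brandt n)"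
    and "f \<vartheta> = g \<vartheta>"
    and "\<And>i j. i \<in> {1..n} \<Longrightarrow> j \<in> {1..n} \<Longrightarrow> f (Elt i j) = g (Elt i j)"
  shows "f = g"
  using assms by (intro extensionalityI[of f "brandt n" g]) (auto simp: brandt_def)

lemma extensional_simps [simp]:
  "fun_comp n f g \<in> extensional (brandt n)"
  "fun_add n f g \<in> extensional (brandt n)"
  "const_map n c \<in> extensional (brandt n)"
  "column_map n p q \<sigma> \<in> extensional (brandt n)"
  "point_map n a b \<in> extensional (brandt n)"
  by (auto simp: fun_comp_def fun_add_def const_map_def column_map_def point_map_def)

lemma columns_subset_maps: "columns n \<subseteq> maps n"
proof
  fix f assume "f \<in> columns n"
  then obtain p q \<sigma> where f: "f = column_map n p q \<sigma>" and pq: "q \<in> {1..n}"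
    and \<sigma>: "\<sigma> permutes {1..n}"
    by (auto simp: columns_def)
  have "f x \<in> brandt n" if "x \<in> brandt n" for x
  proof (cases x)
    case (Elt i j)
    then have ij: "i \<in> {1..n}" "j \<in> {1..n}" using that by (simp_all add: brandt_iffs)
    then show ?thesis using pq permutes_in_image[OF \<sigma>, of i] Elt
      by (auto simp: f brandt_iffs)
  qed (simp add: f brandt_iffs)
  then show "f \<in> maps n"
    by (auto simp: maps_def PiE_iff f)
qed

lemma points_subset_maps: "points n \<subseteq> maps n"
proof -
  have "point_map n a b \<in> maps n" if "b \<in> brandt n" for a b
    using that by (simp add: maps_def PiE_iff brandt_iffs)
  then show ?thesis by (auto simp: points_def)
qed

lemma consts_on_subset_maps: "consts_on n \<subseteq> maps n"
  by (auto simp: consts_on_def intro: const_map_maps)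

lemma maps_apply: "f \<in> maps n \<Longrightarrow> x \<in> brandt n \<Longrightarrow> f x \<in> brandt n"
  by (auto simp: maps_def)

section \<open>Products of these maps\<close>

lemma fun_comp_columns:
  assumes "p \<in> {1..n}" "q \<in> {1..n}" "\<sigma> permutes {1..n}"
  shows "fun_comp n (column_map n p q \<sigma>) (column_map n q' r \<tau>) =
    (if q = q' then column_map n p r (\<tau> \<circ> \<sigma>) else const_map n \<vartheta>)"
proof (rule map_eqI[of _ n])
  fix i j assume ij: "i \<in> {1..n}" "j \<in> {1..n}"
  have "\<sigma> i \<in> {1..n}" using ij permutes_in_image[OF assms(3)] by blast
  then show "fun_comp n (column_map n p q \<sigma>) (column_map n q' r \<tau>) (Elt i j) =
    (if q = q' then column_map n p r (\<tau> \<circ> \<sigma>) else const_map n \<vartheta>) (Elt i j)"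
    using ij assms by (simp add: brandt_iffs)
qed (auto simp: brandt_iffs)

lemma fun_comp_const_left:
  "c \<in> brandt n \<Longrightarrow> fun_comp n (const_map n c) f = const_map n (f c)"
  by (rule map_eqI[of _ n]) (auto simp: brandt_iffs)

lemma fun_comp_const_right:
  "f \<in> maps n \<Longrightarrow> fun_comp n f (const_map n c) = const_map n c"
  by (rule map_eqI[of _ n]) (auto simp: brandt_iffs maps_apply)

lemma fun_comp_point_left:
  "b \<in> brandt n \<Longrightarrow> f \<vartheta> = \<vartheta> \<Longrightarrow> fun_comp n (point_map n a b) f = point_map n a (f b)"
  by (rule map_eqI[of _ n]) (auto simp: brandt_iffs)

text \<open>The support of a product is the preimage of the support of the point map. A column map
  is injective where it does not vanish, so this preimage is a single element or, if
  \<open>q \<noteq> l\<close>, empty.\<close>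

lemma fun_comp_column_point:
  assumes "p \<in> {1..n}" "q \<in> {1..n}" "\<sigma> permutes {1..n}" "k \<in> {1..n}"
  shows "fun_comp n (column_map n p q \<sigma>) (point_map n (Elt k l) b) =
    (if q = l then point_map n (Elt (inv \<sigma> k) p) b else const_map n \<vartheta>)"
proof (rule map_eqI[of _ n])
  fix i j assume ij: "i \<in> {1..n}" "j \<in> {1..n}"
  have "\<sigma> i \<in> {1..n}" using ij permutes_in_image[OF assms(3)] by blast
  moreover have "\<sigma> i = k \<longleftrightarrow> i = inv \<sigma> k"
    using permutes_inverses[OF assms(3)] by metis
  ultimately show "fun_comp n (column_map n p q \<sigma>) (point_map n (Elt k l) b) (Elt i j) =
    (if q = l then point_map n (Elt (inv \<sigma> k) p) b else const_map n \<vartheta>) (Elt i j)"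
    using ij assms by (auto simp add: brandt_iffs)
qed (auto simp: brandt_iffs)

lemma point_map_zero: "point_map n a \<vartheta> = const_map n \<vartheta>"
  by (rule map_eqI[of _ n]) (auto simp: brandt_iffs)

lemma point_map_mem:
  assumes "a \<in> brandt n" "a \<noteq> \<vartheta>" "b \<in> brandt n"
  shows "point_map n a b \<in> points n \<union> consts_on n"
  using assms by (cases "b = \<vartheta>") (auto simp: point_map_zero brandt_iffs intro: pointsI consts_onI)

section \<open>Closure of the explicit set under composition and addition\<close>

definition explicit_maps :: "nat \<Rightarrow> (brandt \<Rightarrow> brandt) set" where
  "explicit_maps n = columns n \<union> points n \<union> consts_on n"

lemma explicit_maps_subset_maps: "explicit_maps n \<subseteq> maps n"
  using columns_subset_maps points_subset_maps consts_on_subset_maps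
  by (auto simp: explicit_maps_def)

lemma columnsE:
  assumes "f \<in> columns n"
  obtains p q \<sigma> where "f = column_map n p q \<sigma>" "p \<in> {1..n}" "q \<in> {1..n}" "\<sigma> permutes {1..n}"
  using assms by (auto simp: columns_def)

lemma pointsE:
  assumes "f \<in> points n"
  obtains k l b where "f = point_map n (Elt k l) b" "k \<in> {1..n}" "l \<in> {1..n}"
    "b \<in> brandt n" "b \<noteq> \<vartheta>"
proof -
  from assms obtain a b where "f = point_map n a b" "a \<in> brandt n" "a \<noteq> \<vartheta>" "b \<in> brandt n" "b \<noteq> \<vartheta>"
    by (auto simp: points_def)
  then show thesis using that by (blast elim: brandt_nonzeroE)
qed

lemma zero_const: "const_map n \<vartheta> \<in> consts_on n"
  by (simp add: consts_onI brandt_iffs)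

text \<open>Serves twice: for the inclusion in \<open>A_plus\<close> and for the inclusion in the
  semigroup generated by \<open>generators\<close>.\<close>

lemma explicit_maps_subsetI:
  assumes "\<And>p q \<sigma>. p \<in> {1..n} \<Longrightarrow> q \<in> {1..n} \<Longrightarrow> \<sigma> permutes {1..n} \<Longrightarrow> column_map n p q \<sigma> \<in> S"
    and "\<And>k l p q. k \<in> {1..n} \<Longrightarrow> l \<in> {1..n} \<Longrightarrow> p \<in> {1..n} \<Longrightarrow> q \<in> {1..n} \<Longrightarrow>
      point_map n (Elt k l) (Elt p q) \<in> S"
    and "\<And>c. c \<in> brandt n \<Longrightarrow> const_map n c \<in> S"
  shows "explicit_maps n \<subseteq> S"
proof
  fix f assume "f \<in> explicit_maps n"
  then consider "f \<in> columns n" | "f \<in> points n" | "f \<in> consts_on n"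
    by (auto simp: explicit_maps_def)
  then show "f \<in> S"
  proof cases
    case 1
    then show ?thesis using assms(1) by (blast elim: columnsE)
  next
    case 2
    then show ?thesis using assms(2) by (metis pointsE brandt_nonzeroE)
  next
    case 3
    then show ?thesis using assms(3) by (auto simp: consts_on_def)
  qed
qed

text \<open>A constant on either side makes the product constant. Otherwise both factors fix
  \<open>\<vartheta>\<close>: a point map in front keeps its support and only its value moves, a
  column map in front of a point map moves the support, and two column maps multiply as in a Brandt
  semigroup.\<close>

lemma explicit_maps_comp:
  assumes f: "f \<in> explicit_maps n" and g: "g \<in> explicit_maps n"
  shows "fun_comp n f g \<in> explicit_maps n"
proof -
  have fm: "f \<in> maps n" and gm: "g \<in> maps n" using f g explicit_maps_subset_maps by auto
  consider "f \<in> consts_on n" | "g \<in> consts_on n"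
    | "f \<in> points n" "g \<in> columns n \<union> points n"
    | "f \<in> columns n" "g \<in> columns n" | "f \<in> columns n" "g \<in> points n"
    using f g by (auto simp: explicit_maps_def)
  then show ?thesis
  proof cases
    case 1
    then show ?thesis using gm
      by (auto simp: explicit_maps_def consts_on_def fun_comp_const_left maps_apply)
  next
    case 2
    then show ?thesis using fm
      by (auto simp: explicit_maps_def consts_on_def fun_comp_const_right)
  next
    case 3
    have "g \<vartheta> = \<vartheta>" using 3(2) by (auto elim!: columnsE pointsE simp: brandt_iffs)
    moreover from 3(1) obtain k l b where F: "f = point_map n (Elt k l) b" "k \<in> {1..n}"
      "l \<in> {1..n}" "b \<in> brandt n" "b \<noteq> \<vartheta>" by (rule pointsE)
    ultimately have "fun_comp n f g = point_map n (Elt k l) (g b)"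
      by (simp add: fun_comp_point_left)
    then show ?thesis
      using point_map_mem[of "Elt k l" n "g b"] maps_apply[OF gm F(4)] F(2,3)
      by (auto simp: explicit_maps_def brandt_iffs)
  next
    case 4
    then show ?thesis using zero_const[of n]
      by (auto simp: explicit_maps_def fun_comp_columns elim!: columnsE
          intro!: columnsI permutes_compose)
  next
    case 5
    from 5(1) obtain p q \<sigma> where F: "f = column_map n p q \<sigma>" "p \<in> {1..n}" "q \<in> {1..n}"
      "\<sigma> permutes {1..n}" by (rule columnsE)
    from 5(2) obtain k l b where G: "g = point_map n (Elt k l) b" "k \<in> {1..n}" "l \<in> {1..n}"
      "b \<in> brandt n" "b \<noteq> \<vartheta>" by (rule pointsE)
    have "inv \<sigma> k \<in> {1..n}" using G(2) permutes_in_image[OF permutes_inv[OF F(4)]] by blast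
    then show ?thesis using zero_const[of n] F(2) G(4,5)
      by (auto simp: explicit_maps_def F(1) G(1) fun_comp_column_point[OF F(2-4) G(2)] brandt_iffs
          intro!: pointsI)
  qed
qed

text \<open>Lets sums be classified by bounding their support, without computing the value at the
  remaining point.\<close>

lemma supported_at_point:
  assumes f: "f \<in> maps n" and a: "a \<in> brandt n" "a \<noteq> \<vartheta>"
    and z: "\<And>x. x \<in> brandt n \<Longrightarrow> x \<noteq> a \<Longrightarrow> f x = \<vartheta>"
  shows "f \<in> points n \<union> consts_on n"
proof -
  have "f = point_map n a (f a)"
  proof (rule map_eqI[of _ n])
    show "f \<in> extensional (brandt n)" using f by (auto simp: maps_def PiE_def)
  qed (use z a in \<open>auto simp: brandt_iffs\<close>)
  then show ?thesis using point_map_mem[OF a maps_apply[OF f a(1)]] by simp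
qed

text \<open>Addition is not symmetric here. A column map plus a constant only has its second
  coordinate tested and changed, so it is a column map or zero. A column map as right summand has
  its first coordinate tested, and this varies bijectively with \<open>i\<close>, so at most one
  point of the column survives.\<close>

lemma explicit_maps_add:
  assumes f: "f \<in> explicit_maps n" and g: "g \<in> explicit_maps n"
  shows "fun_add n f g \<in> explicit_maps n"
proof -
  have fm: "f \<in> maps n" and gm: "g \<in> maps n" using f g explicit_maps_subset_maps by auto
  note sm = fun_add_maps[OF fm gm]
  consider "f \<in> consts_on n" "g \<in> consts_on n" | "f \<in> points n \<or> g \<in> points n"
    | "f \<in> columns n" "g \<in> columns n" | "f \<in> columns n" "g \<in> consts_on n"
    | "f \<in> consts_on n" "g \<in> columns n"
    using f g by (auto simp: explicit_maps_def)
  then show ?thesis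
  proof cases
    case 1
    then obtain c d where "f = const_map n c" "g = const_map n d" "c \<in> brandt n" "d \<in> brandt n"
      by (auto simp: consts_on_def)
    moreover from this have "fun_add n f g = const_map n (c \<oplus>\<^sub>B d)"
      by (intro map_eqI[of _ n]) (auto simp: brandt_iffs)
    ultimately show ?thesis by (simp add: explicit_maps_def consts_onI brandt_add_closed)
  next
    case 2
    then obtain k l b where "f = point_map n (Elt k l) b \<or> g = point_map n (Elt k l) b"
      and kl: "k \<in> {1..n}" "l \<in> {1..n}" by (metis pointsE)
    then have "fun_add n f g \<in> points n \<union> consts_on n"
      by (intro supported_at_point[OF sm, of "Elt k l"]) (auto simp: brandt_iffs)
    then show ?thesis by (auto simp: explicit_maps_def)
  next
    case 3
    from 3(1) obtain p q \<sigma> where F: "f = column_map n p q \<sigma>" "p \<in> {1..n}" "q \<in> {1..n}"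
      "\<sigma> permutes {1..n}" by (rule columnsE)
    from 3(2) obtain p' q' \<tau> where G: "g = column_map n p' q' \<tau>" "p' \<in> {1..n}" "q' \<in> {1..n}"
      "\<tau> permutes {1..n}" by (rule columnsE)
    have i: "inv \<tau> q \<in> {1..n}" using F(3) permutes_in_image[OF permutes_inv[OF G(4)]] by blast
    have "fun_add n f g \<in> points n \<union> consts_on n"
    proof (rule supported_at_point[OF sm, of "Elt (inv \<tau> q) p"])
      fix x assume x: "x \<in> brandt n" "x \<noteq> Elt (inv \<tau> q) p"
      show "fun_add n f g x = \<vartheta>"
      proof (cases x)
        case (Elt i j)
        moreover have "\<tau> i = q \<longleftrightarrow> i = inv \<tau> q"
          using permutes_inverses[OF G(4)] by metis
        ultimately show ?thesis using x by (auto simp: F(1) G(1) brandt_iffs)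
      qed (simp add: F(1) G(1) brandt_iffs)
    qed (use F(2) i in \<open>auto simp: brandt_iffs\<close>)
    then show ?thesis by (auto simp: explicit_maps_def)
  next
    case 4
    from 4(1) obtain p q \<sigma> where F: "f = column_map n p q \<sigma>" "p \<in> {1..n}" "q \<in> {1..n}"
      "\<sigma> permutes {1..n}" by (rule columnsE)
    from 4(2) obtain c where G: "g = const_map n c" "c \<in> brandt n" by (auto simp: consts_on_def)
    show ?thesis
    proof (cases "\<exists>s. c = Elt q s")
      case True
      then obtain s where s: "c = Elt q s" ..
      have "fun_add n f g = column_map n p s \<sigma>"
        by (rule map_eqI[of _ n]) (auto simp: F(1) G(1) s brandt_iffs)
      then show ?thesis using F G(2) s by (simp add: explicit_maps_def columnsI brandt_iffs)
    next
      case False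
      then have "fun_add n f g = const_map n \<vartheta>"
        by (intro map_eqI[of _ n]; cases c) (auto simp: F(1) G(1) brandt_iffs)
      then show ?thesis by (simp add: explicit_maps_def zero_const)
    qed
  next
    case 5
    from 5(2) obtain p q \<sigma> where G: "g = column_map n p q \<sigma>" "p \<in> {1..n}" "q \<in> {1..n}"
      "\<sigma> permutes {1..n}" by (rule columnsE)
    from 5(1) obtain c where F: "f = const_map n c" "c \<in> brandt n" by (auto simp: consts_on_def)
    show ?thesis
    proof (cases c)
      case Theta
      then have "fun_add n f g = const_map n \<vartheta>"
        by (intro map_eqI[of _ n]) (auto simp: F(1) brandt_iffs)
      then show ?thesis by (simp add: explicit_maps_def zero_const)
    next
      case (Elt r s)
      have i: "inv \<sigma> s \<in> {1..n}"
        using F(2) Elt permutes_in_image[OF permutes_inv[OF G(4)], of s]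
        by (simp add: brandt_iffs)
      have "fun_add n f g \<in> points n \<union> consts_on n"
      proof (rule supported_at_point[OF sm, of "Elt (inv \<sigma> s) p"])
        fix x assume x: "x \<in> brandt n" "x \<noteq> Elt (inv \<sigma> s) p"
        show "fun_add n f g x = \<vartheta>"
        proof (cases x)
          case X: (Elt i j)
          moreover have "\<sigma> i = s \<longleftrightarrow> i = inv \<sigma> s"
            using permutes_inverses[OF G(4)] by metis
          ultimately show ?thesis using x by (auto simp: F(1) G(1) Elt brandt_iffs)
        qed (simp add: F(1) G(1) brandt_iffs)
      qed (use G(2) i in \<open>auto simp: brandt_iffs\<close>)
      then show ?thesis by (auto simp: explicit_maps_def)
    qed
  qed
qed

section \<open>Endomorphisms, affine maps and the explicit description of
  \<open>A_plus\<close>\<close>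

definition automorphism_map :: "nat \<Rightarrow> (nat \<Rightarrow> nat) \<Rightarrow> brandt \<Rightarrow> brandt" where
  "automorphism_map n \<sigma> = (\<lambda>x\<in>brandt n. case x of \<vartheta> \<Rightarrow> \<vartheta> | Elt i j \<Rightarrow> Elt (\<sigma> i) (\<sigma> j))"

lemma automorphism_map_simps [simp]:
  "automorphism_map n \<sigma> \<vartheta> = \<vartheta>"
  "i \<in> {1..n} \<Longrightarrow> j \<in> {1..n} \<Longrightarrow> automorphism_map n \<sigma> (Elt i j) = Elt (\<sigma> i) (\<sigma> j)"
  "automorphism_map n \<sigma> \<in> extensional (brandt n)"
  by (simp_all add: automorphism_map_def brandt_iffs)

lemma automorphism_map_endomorphism:
  assumes \<sigma>: "\<sigma> permutes {1..n}"
  shows "automorphism_map n \<sigma> \<in> endomorphisms n"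
proof -
  have m: "\<sigma> i \<in> {1..n}" if "i \<in> {1..n}" for i
    using permutes_in_image[OF \<sigma>] that by blast
  have "automorphism_map n \<sigma> \<in> maps n"
    unfolding maps_def PiE_iff
  proof (intro conjI ballI)
    fix x assume "x \<in> brandt n"
    then show "automorphism_map n \<sigma> x \<in> brandt n" using m by (cases x) (auto simp: brandt_iffs)
  qed simp
  moreover have "automorphism_map n \<sigma> (x \<oplus>\<^sub>B y) = automorphism_map n \<sigma> x \<oplus>\<^sub>B automorphism_map n \<sigma> y"
    if "x \<in> brandt n" "y \<in> brandt n" for x y
    using that inj_eq[OF permutes_inj[OF \<sigma>]] by (cases x; cases y) (auto simp: brandt_iffs)
  ultimately show ?thesis by (auto simp: endomorphisms_def)
qed

lemma const_idempotent_endomorphism: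
  "c \<in> brandt n \<Longrightarrow> c \<oplus>\<^sub>B c = c \<Longrightarrow> const_map n c \<in> endomorphisms n"
  by (auto simp: endomorphisms_def const_map_maps brandt_add_closed)

text \<open>If \<open>\<vartheta>\<close> is not fixed, its image absorbs every other image, so
  \<open>g\<close> is constant. If \<open>\<vartheta>\<close> is fixed and some
  \<open>Elt i j\<close> is sent to it, then so is every element, since each one factors through
  \<open>Elt i j\<close>. Otherwise the action on the idempotents \<open>Elt i i\<close> is a
  permutation that determines \<open>g\<close>.\<close>

lemma endomorphism_cases:
  assumes g: "g \<in> endomorphisms n"
  obtains c where "c \<in> brandt n" "g = const_map n c"
  | \<sigma> where "\<sigma> permutes {1..n}" "g = automorphism_map n \<sigma>"
proof -
  have gm: "g \<in> maps n" and hom: "\<And>x y. x \<in> brandt n \<Longrightarrow> y \<in> brandt n \<Longrightarrow> g (x \<oplus>\<^sub>B y) = g x \<oplus>\<^sub>B g y"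
    using g by (auto simp: endomorphisms_def)
  have ext: "g \<in> extensional (brandt n)" using gm by (auto simp: maps_def PiE_def)
  have zB: "\<vartheta> \<in> brandt n" by (simp add: brandt_iffs)
  consider "g \<vartheta> \<noteq> \<vartheta>" | "g \<vartheta> = \<vartheta>" "\<exists>i\<in>{1..n}. \<exists>j\<in>{1..n}. g (Elt i j) = \<vartheta>"
    | "g \<vartheta> = \<vartheta>" "\<And>i j. i \<in> {1..n} \<Longrightarrow> j \<in> {1..n} \<Longrightarrow> g (Elt i j) \<noteq> \<vartheta>" by blast
  then show ?thesis
  proof cases
    case 1
    have const: "g x = g \<vartheta>" if "x \<in> brandt n" for x
    proof (rule brandt_two_sided_unit)
      show "g x \<oplus>\<^sub>B g \<vartheta> = g \<vartheta>" "g \<vartheta> \<oplus>\<^sub>B g x = g \<vartheta>"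
        using hom[OF that zB, symmetric] hom[OF zB that, symmetric] by simp_all
    qed (rule 1)
    have "g = const_map n (g \<vartheta>)"
    proof (rule extensionalityI[OF ext extensional_simps(3)])
      fix x assume x: "x \<in> brandt n"
      show "g x = const_map n (g \<vartheta>) x"
        unfolding const_map_apply[OF x] by (rule const[OF x])
    qed
    then show ?thesis using that(1) maps_apply[OF gm zB] by blast
  next
    case 2
    then obtain i j where ij: "i \<in> {1..n}" "j \<in> {1..n}" "g (Elt i j) = \<vartheta>" by blast
    have "g (Elt k l) = \<vartheta>" if "k \<in> {1..n}" "l \<in> {1..n}" for k l
    proof -
      have "g (Elt k l) = g (Elt k i \<oplus>\<^sub>B (Elt i j \<oplus>\<^sub>B Elt j l))" by simp
      also have "\<dots> = g (Elt k i) \<oplus>\<^sub>B (g (Elt i j) \<oplus>\<^sub>B g (Elt j l))"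
        using hom ij that by (simp add: brandt_iffs brandt_add_closed del: brandt_add.simps(1))
      finally show ?thesis using ij by simp
    qed
    then have "g = const_map n \<vartheta>"
      using 2 by (intro map_eqI[of _ n]) (auto simp: ext brandt_iffs)
    then show ?thesis using that(1) zB by blast
  next
    case 3
    \<comment> \<open>Idempotents go to idempotents, and the nonzero idempotents are the diagonal
      elements.\<close>
    have "\<forall>i\<in>{1..n}. \<exists>k\<in>{1..n}. g (Elt i i) = Elt k k"
    proof
      fix i assume i: "i \<in> {1..n}"
      have "g (Elt i i) \<oplus>\<^sub>B g (Elt i i) = g (Elt i i)"
        using hom[of "Elt i i" "Elt i i", symmetric] i by (simp add: brandt_iffs)
      then show "\<exists>k\<in>{1..n}. g (Elt i i) = Elt k k"
        using 3(2)[OF i i] maps_apply[OF gm, of "Elt i i"] i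
        by (cases "g (Elt i i)") (auto simp: brandt_iffs split: if_splits)
    qed
    then obtain s where s: "\<And>i. i \<in> {1..n} \<Longrightarrow> s i \<in> {1..n} \<and> g (Elt i i) = Elt (s i) (s i)"
      by metis
    \<comment> \<open>Distinct diagonal elements add up to \<open>\<vartheta>\<close>; with equal
      images the image of the sum would be a nonzero idempotent.\<close>
    have "inj_on s {1..n}"
    proof (rule inj_onI, rule ccontr)
      fix i j assume ij: "i \<in> {1..n}" "j \<in> {1..n}" "s i = s j" "i \<noteq> j"
      then have "g \<vartheta> = g (Elt i i) \<oplus>\<^sub>B g (Elt j j)"
        using hom[of "Elt i i" "Elt j j"] by (simp add: brandt_iffs)
      then show False using s ij 3(1) by simp
    qed
    \<comment> \<open>\<open>permutes\<close> asks for the identity outside the index range, where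
      nothing is known about \<open>s\<close>.\<close>
    define \<sigma> where "\<sigma> = (\<lambda>i. if i \<in> {1..n} then s i else i)"
    have "inj_on \<sigma> {1..n}"
      using \<open>inj_on s {1..n}\<close> by (rule inj_on_cong[THEN iffD1, rotated]) (simp add: \<sigma>_def)
    moreover have "\<sigma> ` {1..n} \<subseteq> {1..n}"
    proof (rule image_subsetI)
      fix i assume i: "i \<in> {1..n}"
      then show "\<sigma> i \<in> {1..n}" using s[OF i] by (simp add: \<sigma>_def)
    qed
    ultimately have bij: "bij_betw \<sigma> {1..n} {1..n}"
      by (simp add: bij_betw_def endo_inj_surj)
    have \<sigma>: "\<sigma> permutes {1..n}"
      by (rule bij_imp_permutes[OF bij]) (auto simp: \<sigma>_def)
    have "g (Elt i j) = Elt (s i) (s j)" if ij: "i \<in> {1..n}" "j \<in> {1..n}" for i j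
    proof -
      have "g (Elt i j) = g (Elt i i \<oplus>\<^sub>B (Elt i j \<oplus>\<^sub>B Elt j j))" by simp
      also have "\<dots> = g (Elt i i) \<oplus>\<^sub>B (g (Elt i j) \<oplus>\<^sub>B g (Elt j j))"
        using hom ij by (simp add: brandt_iffs brandt_add_closed del: brandt_add.simps(1))
      finally have "Elt (s i) (s i) \<oplus>\<^sub>B (g (Elt i j) \<oplus>\<^sub>B Elt (s j) (s j)) = g (Elt i j)"
        using s[OF ij(1)] s[OF ij(2)] by metis
      then show ?thesis using 3(2)[OF ij] by (rule brandt_sandwich)
    qed
    then have "g = automorphism_map n \<sigma>"
      using 3(1) by (intro map_eqI[of _ n]) (auto simp: ext \<sigma>_def)
    then show ?thesis using that(2) \<sigma> by blast
  qed
qed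

text \<open>The summand \<open>Elt (\<sigma> p) q\<close> kills every column but the one with
  \<open>\<sigma> j = \<sigma> p\<close>, that is \<open>j = p\<close>. This is how column maps
  arise as affine maps.\<close>

lemma automorphism_add_const:
  assumes "\<sigma> permutes {1..n}" "p \<in> {1..n}"
  shows "fun_add n (automorphism_map n \<sigma>) (const_map n (Elt (\<sigma> p) q)) = column_map n p q \<sigma>"
  using inj_eq[OF permutes_inj[OF assms(1)]]
  by (intro map_eqI[of _ n]) (auto simp: brandt_iffs)

lemma Aff_subset_explicit: "Aff n \<subseteq> explicit_maps n"
proof
  fix f assume "f \<in> Aff n"
  then obtain g c where f: "f = fun_add n g (const_map n c)" and g: "g \<in> endomorphisms n"
    and c: "c \<in> brandt n" by (auto simp: Aff_def)
  from g show "f \<in> explicit_maps n"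
  proof (cases rule: endomorphism_cases)
    case (1 d)
    then show ?thesis using c unfolding f
      by (intro explicit_maps_add) (simp_all add: explicit_maps_def consts_onI)
  next
    case (2 \<sigma>)
    show ?thesis
    proof (cases c)
      case Theta
      then have "f = const_map n \<vartheta>" by (intro map_eqI[of _ n]) (auto simp: f brandt_iffs)
      then show ?thesis by (simp add: explicit_maps_def zero_const)
    next
      case (Elt r s)
      then have rs: "r \<in> {1..n}" "s \<in> {1..n}" using c by (simp_all add: brandt_iffs)
      \<comment> \<open>The surviving column is the one whose index \<open>\<sigma>\<close> sends to
        \<open>r\<close>.\<close>
      have i: "inv \<sigma> r \<in> {1..n}" using rs permutes_in_image[OF permutes_inv[OF 2(1)]] by blast
      have "f = column_map n (inv \<sigma> r) s \<sigma>"
        using automorphism_add_const[OF 2(1) i, of s] permutes_inverses(1)[OF 2(1)]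
        by (simp add: f Elt 2(2))
      then show ?thesis using i rs 2(1) by (simp add: explicit_maps_def columnsI)
    qed
  qed
qed

lemma const_in_Aff:
  assumes "c \<in> brandt n"
  shows "const_map n c \<in> Aff n"
proof -
  \<comment> \<open>A constant endomorphism needs an idempotent value, so \<open>e\<close> is taken
    to be an idempotent left unit of \<open>c\<close>.\<close>
  obtain e where "e \<in> brandt n" "e \<oplus>\<^sub>B e = e" "e \<oplus>\<^sub>B c = c"
  proof (cases c)
    case (Elt i j)
    then show thesis using that[of "Elt i i"] assms by (simp add: brandt_iffs)
  qed (use that[of \<vartheta>] brandt_iffs in auto)
  moreover from this have "const_map n c = fun_add n (const_map n e) (const_map n c)"
    by (intro map_eqI[of _ n]) (auto simp: brandt_iffs)
  ultimately show ?thesis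
    unfolding Aff_def using const_idempotent_endomorphism assms by blast
qed

lemma column_in_Aff:
  assumes "p \<in> {1..n}" "q \<in> {1..n}" "\<sigma> permutes {1..n}"
  shows "column_map n p q \<sigma> \<in> Aff n"
proof -
  have "Elt (\<sigma> p) q \<in> brandt n"
    using assms permutes_in_image[OF assms(3), of p] by (simp add: brandt_iffs)
  then show ?thesis
    unfolding Aff_def
    using automorphism_map_endomorphism[OF assms(3)] automorphism_add_const[OF assms(3,1), of q]
    by (auto intro!: exI[of _ "automorphism_map n \<sigma>"] exI[of _ "Elt (\<sigma> p) q"])
qed

text \<open>The known explicit description, proved here from the definitions. Column maps and
  constants are affine; the point maps come from addition.\<close>

lemma A_plus_eq_explicit: "A_plus n = explicit_maps n"
proof
  show "A_plus n \<subseteq> explicit_maps n"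
  proof
    fix f assume "f \<in> A_plus n"
    then show "f \<in> explicit_maps n"
      by induction (use Aff_subset_explicit explicit_maps_add explicit_maps_comp in blast)+
  qed
next
  have col: "column_map n p q \<sigma> \<in> A_plus n"
    if "p \<in> {1..n}" "q \<in> {1..n}" "\<sigma> permutes {1..n}" for p q \<sigma>
    using that by (intro A_plus.affine column_in_Aff)
  have const: "const_map n c \<in> A_plus n" if "c \<in> brandt n" for c
    using that by (intro A_plus.affine const_in_Aff)
  have "point_map n (Elt k l) (Elt p q) \<in> A_plus n"
    if "k \<in> {1..n}" "l \<in> {1..n}" "p \<in> {1..n}" "q \<in> {1..n}" for k l p q
  proof -
    \<comment> \<open>In column \<open>l\<close> the sum is \<open>Elt p k\<close> plus
      \<open>Elt i q\<close>, which is nonzero only for \<open>i = k\<close>.\<close>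
    have "point_map n (Elt k l) (Elt p q) = fun_add n (const_map n (Elt p k)) (column_map n l q id)"
      by (rule map_eqI[of _ n]) (auto simp: brandt_iffs)
    also have "\<dots> \<in> A_plus n"
      using that by (intro A_plus.add const col) (auto simp: brandt_iffs permutes_id)
    finally show ?thesis .
  qed
  then show "explicit_maps n \<subseteq> A_plus n"
    using col const by (intro explicit_maps_subsetI)
qed

section \<open>Lower bound: labelled paths and factors of products\<close>

lemma generated_subset:
  fixes mult :: "'a \<Rightarrow> 'a \<Rightarrow> 'a"
  assumes "U \<subseteq> S" "\<And>x y. x \<in> S \<Longrightarrow> y \<in> S \<Longrightarrow> mult x y \<in> S"
  shows "generated mult U \<subseteq> S"
proof
  fix x assume "x \<in> generated mult U"
  then show "x \<in> S" by induction (use assms in auto)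
qed

text \<open>The number \<open>m\<close> is one less than the number of edges, since paths are
  nonempty. Labels compose as in \<open>fun_comp_columns\<close>, the first edge acting
  first.\<close>

inductive path :: "(nat \<times> nat \<times> (nat \<Rightarrow> nat)) set \<Rightarrow> nat \<Rightarrow> nat \<Rightarrow> nat \<Rightarrow> (nat \<Rightarrow> nat) \<Rightarrow> bool"
  for E where
  edge: "(p, q, \<sigma>) \<in> E \<Longrightarrow> path E 0 p q \<sigma>"
| step: "(p, q, \<sigma>) \<in> E \<Longrightarrow> path E m q r \<tau> \<Longrightarrow> path E (Suc m) p r (\<tau> \<circ> \<sigma>)"

lemma path_trans:
  "path E a p q \<sigma> \<Longrightarrow> path E b q r \<tau> \<Longrightarrow> path E (Suc (a + b)) p r (\<tau> \<circ> \<sigma>)"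
proof (induction rule: path.induct)
  case (edge p q \<sigma>)
  then show ?case using path.step[OF edge(1,2)] by (simp add: comp_def)
next
  case (step p q \<sigma> m r' \<tau>')
  then show ?case using path.step[OF step(1) step.IH[OF step.prems]] by (simp add: comp_def)
qed

lemma path_first_edge: "path E m p q \<sigma> \<Longrightarrow> p \<in> fst ` E"
  by (induction rule: path.induct) force+

text \<open>Injectivity of \<open>fst\<close> on \<open>E\<close> says that each vertex has at most
  one outgoing edge, so every step of a path is forced.\<close>

lemma path_deterministic:
  assumes "inj_on fst E"
  shows "path E m p q \<sigma> \<Longrightarrow> path E m p q' \<sigma>' \<Longrightarrow> q = q' \<and> \<sigma> = \<sigma>'"
proof (induction arbitrary: q' \<sigma>' rule: path.induct)
  case (edge p q \<sigma>)
  from edge(2) have "(p, q', \<sigma>') \<in> E" by cases auto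
  then show ?case using edge(1) inj_onD[OF assms, of "(p, q, \<sigma>)" "(p, q', \<sigma>')"] by simp
next
  case (step p q \<sigma> m r \<tau>)
  from step(4) obtain q1 \<sigma>1 \<tau>1 where 1: "(p, q1, \<sigma>1) \<in> E" "path E m q1 q' \<tau>1" "\<sigma>' = \<tau>1 \<circ> \<sigma>1"
    by cases auto
  have "q1 = q \<and> \<sigma>1 = \<sigma>" using 1(1) step(1) inj_onD[OF assms, of "(p, q, \<sigma>)" "(p, q1, \<sigma>1)"] by simp
  then show ?case using step.IH 1 by auto
qed

text \<open>Column \<open>p\<close> is where the map is nonzero, and its values there give
  \<open>q\<close> and \<open>\<sigma>\<close> on the indices; elsewhere both permutations are the
  identity.\<close>

lemma column_map_inj:
  assumes eq: "column_map n p q \<sigma> = column_map n p' q' \<sigma>'"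
    and p: "p \<in> {1..n}" and \<sigma>: "\<sigma> permutes {1..n}" "\<sigma>' permutes {1..n}"
  shows "p = p' \<and> q = q' \<and> \<sigma> = \<sigma>'"
proof -
  have *: "p = p' \<and> q = q' \<and> \<sigma> i = \<sigma>' i" if "i \<in> {1..n}" for i
    using fun_cong[OF eq, of "Elt i p"] that p by (auto split: if_splits)
  moreover have "\<sigma> i = \<sigma>' i" if "i \<notin> {1..n}" for i
    using permutes_not_in[OF \<sigma>(1) that] permutes_not_in[OF \<sigma>(2) that] by simp
  ultimately show ?thesis using p by blast
qed

text \<open>Characterises column maps by their values alone, in a form that passes from a product to
  its factors. Rows 1 and 2 supply the two values.\<close>

lemma column_iff_two_values:
  assumes "n \<ge> 2" "f \<in> explicit_maps n"
  shows "f \<in> columns n \<longleftrightarrow>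
    (\<exists>x\<in>brandt n. \<exists>y\<in>brandt n. f x \<noteq> \<vartheta> \<and> f y \<noteq> \<vartheta> \<and> f x \<noteq> f y)" (is "_ \<longleftrightarrow> ?R")
proof
  assume "f \<in> columns n"
  then obtain p q \<sigma> where F: "f = column_map n p q \<sigma>" "p \<in> {1..n}" "q \<in> {1..n}"
    "\<sigma> permutes {1..n}" by (rule columnsE)
  then show ?R using assms(1) inj_eq[OF permutes_inj[OF F(4)], of 1 2]
    by (intro bexI[of _ "Elt 1 p"] bexI[of _ "Elt 2 p"]) (auto simp: brandt_iffs)
next
  assume ?R
  then show "f \<in> columns n" using assms(2)
    by (auto simp: explicit_maps_def consts_on_def elim!: pointsE split: if_splits)
qed

text \<open>Two distinct nonzero values of the product are values of \<open>g\<close>, so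
  \<open>g\<close> is a column map. It then fixes \<open>\<vartheta>\<close>, so the two arguments
  it receives from \<open>f\<close> are also nonzero and distinct.\<close>

lemma column_factors:
  assumes n: "n \<ge> 2" and f: "f \<in> explicit_maps n" and g: "g \<in> explicit_maps n"
    and fg: "fun_comp n f g \<in> columns n"
  shows "f \<in> columns n \<and> g \<in> columns n"
proof -
  have fm: "f \<in> maps n" using f explicit_maps_subset_maps by auto
  obtain x y where xy: "x \<in> brandt n" "y \<in> brandt n"
    "g (f x) \<noteq> \<vartheta>" "g (f y) \<noteq> \<vartheta>" "g (f x) \<noteq> g (f y)"
    using fg column_iff_two_values[OF n explicit_maps_comp[OF f g]] by auto
  have gc: "g \<in> columns n"
    using column_iff_two_values[OF n g] xy maps_apply[OF fm] by blast
  then have "g \<vartheta> = \<vartheta>" by (auto elim: columnsE)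
  then have "f x \<noteq> \<vartheta>" "f y \<noteq> \<vartheta>" "f x \<noteq> f y" using xy by metis+
  then show ?thesis using column_iff_two_values[OF n f] xy gc by blast
qed

lemma columns_disjoint_consts: "n \<ge> 2 \<Longrightarrow> columns n \<inter> consts_on n = {}"
  using column_iff_two_values[of n] by (force simp: explicit_maps_def consts_on_def)

lemma points_disjoint_consts: "n \<ge> 2 \<Longrightarrow> points n \<inter> consts_on n = {}"
proof -
  have "point_map n (Elt k l) b \<noteq> const_map n c"
    if "k \<in> {1..n}" "l \<in> {1..n}" "b \<noteq> \<vartheta>" for k l b c
  proof
    assume eq: "point_map n (Elt k l) b = const_map n c"
    show False using that fun_cong[OF eq, of "Elt k l"] fun_cong[OF eq, of \<vartheta>]
      by (simp add: brandt_iffs)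
  qed
  then show ?thesis by (auto simp: consts_on_def elim!: pointsE)
qed

lemma columns_disjoint_points: "n \<ge> 2 \<Longrightarrow> columns n \<inter> points n = {}"
proof (rule ccontr)
  assume n: "n \<ge> 2" and "columns n \<inter> points n \<noteq> {}"
  then obtain f where f: "f \<in> columns n" "f \<in> points n" by blast
  then have "f \<in> explicit_maps n" by (simp add: explicit_maps_def)
  then show False using f column_iff_two_values[OF n]
    by (fastforce elim!: pointsE split: if_splits)
qed

lemma generators_include_point:
  assumes n: "n \<ge> 2" and U: "U \<subseteq> explicit_maps n"
    and gen: "generated (fun_comp n) U = explicit_maps n"
  shows "U \<inter> points n \<noteq> {}"
proof
  assume "U \<inter> points n = {}"
  then have "U \<subseteq> columns n \<union> consts_on n" using U by (auto simp: explicit_maps_def)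
  \<comment> \<open>Column maps and constants together form a subsemigroup.\<close>
  moreover have "fun_comp n f g \<in> columns n \<union> consts_on n"
    if f: "f \<in> columns n \<union> consts_on n" and g: "g \<in> columns n \<union> consts_on n" for f g
  proof -
    have fm: "f \<in> maps n" and gm: "g \<in> maps n"
      using f g columns_subset_maps consts_on_subset_maps by auto
    consider "f \<in> consts_on n" | "g \<in> consts_on n" | "f \<in> columns n" "g \<in> columns n"
      using f g by blast
    then show ?thesis
    proof cases
      case 1
      then show ?thesis using gm by (auto simp: consts_on_def fun_comp_const_left maps_apply)
    next
      case 2
      then show ?thesis using fm by (auto simp: consts_on_def fun_comp_const_right)
    next
      case 3
      then show ?thesis using zero_const[of n]
        by (auto simp: fun_comp_columns elim!: columnsE intro!: columnsI permutes_compose)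
    qed
  qed
  ultimately have "generated (fun_comp n) U \<subseteq> columns n \<union> consts_on n"
    by (rule generated_subset)
  moreover have "point_map n (Elt 1 1) (Elt 1 1) \<in> points n"
    using n by (intro pointsI) (auto simp: brandt_iffs)
  ultimately show False
    using gen columns_disjoint_points[OF n] points_disjoint_consts[OF n]
    by (auto simp: explicit_maps_def)
qed

lemma generators_include_const:
  assumes n: "n \<ge> 2" and U: "U \<subseteq> explicit_maps n"
    and gen: "generated (fun_comp n) U = explicit_maps n"
  shows "U \<inter> consts_on n \<noteq> {}"
proof
  assume "U \<inter> consts_on n = {}"
  then have "U \<subseteq> columns n \<union> points n" using U by (auto simp: explicit_maps_def)
  then have "U \<subseteq> {f. f \<vartheta> = \<vartheta>}" by (fastforce elim: columnsE pointsE simp: brandt_iffs)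
  \<comment> \<open>Fixing \<open>\<vartheta>\<close> is preserved by composition.\<close>
  then have "generated (fun_comp n) U \<subseteq> {f. f \<vartheta> = \<vartheta>}"
    by (rule generated_subset) (simp add: brandt_iffs)
  moreover have "const_map n (Elt 1 1) \<in> explicit_maps n"
    using n by (simp add: explicit_maps_def consts_onI brandt_iffs)
  ultimately show False using gen by (auto simp: brandt_iffs)
qed

text \<open>A column map is an edge \<open>p \<rightarrow> q\<close> labelled by a permutation, and products of column maps are
  paths. If there were at most \<open>n\<close> generating edges, each vertex would have exactly one outgoing
  edge. A path would then be determined by its start and its length, so loops at a vertex, and
  hence all permutations, would commute.\<close>

lemma generators_include_columns:
  assumes n: "n \<ge> 3" and U: "U \<subseteq> explicit_maps n"
    and gen: "generated (fun_comp n) U = explicit_maps n"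
  shows "card (U \<inter> columns n) \<ge> n + 1"
proof (rule ccontr)
  assume less: "\<not> card (U \<inter> columns n) \<ge> n + 1"
  \<comment> \<open>The column maps in \<open>U\<close> as labelled edges. Distinct edges give
    distinct maps, so the assumption \<open>less\<close> bounds the number of edges by
    \<open>n\<close>.\<close>
  define E where "E = {(p, q, \<sigma>). p \<in> {1..n} \<and> q \<in> {1..n} \<and> \<sigma> permutes {1..n} \<and>
    column_map n p q \<sigma> \<in> U}"
  have finU: "finite U"
    using U A_plus_eq_explicit finite_A_plus finite_subset by metis
  have injE: "inj_on (\<lambda>(p, q, \<sigma>). column_map n p q \<sigma>) E"
    by (rule inj_onI) (auto simp: E_def dest: column_map_inj)
  have imE: "(\<lambda>(p, q, \<sigma>). column_map n p q \<sigma>) ` E \<subseteq> U \<inter> columns n"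
    by (auto simp: E_def intro: columnsI)
  have finE: "finite E"
    using injE imE finU by (meson finite_Int finite_subset inj_on_finite)
  have cardE: "card E \<le> n"
    using card_inj_on_le[OF injE imE] finU less by simp
  \<comment> \<open>Induction over generation: by \<open>column_factors\<close> both factors are
    column maps again, and their middle indices agree because otherwise the product would be the
    zero constant. The two paths can therefore be joined.\<close>
  have path: "\<exists>m. path E m p q \<sigma>"
    if "f \<in> generated (fun_comp n) U" "f = column_map n p q \<sigma>" "p \<in> {1..n}" "q \<in> {1..n}"
      "\<sigma> permutes {1..n}" for f p q \<sigma>
    using that
  proof (induction arbitrary: p q \<sigma>)
    case (gen x)
    then have "(p, q, \<sigma>) \<in> E" by (auto simp: E_def)
    then show ?case by (blast intro: path.edge)
  next
    case (mult x y)
    have xy: "x \<in> explicit_maps n" "y \<in> explicit_maps n" using mult.hyps gen by auto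
    have c: "fun_comp n x y \<in> columns n" using mult.prems by (auto intro: columnsI)
    with column_factors[OF _ xy] n have cc: "x \<in> columns n" "y \<in> columns n" by auto
    from cc(1) obtain p1 q1 \<sigma>1 where X: "x = column_map n p1 q1 \<sigma>1" "p1 \<in> {1..n}" "q1 \<in> {1..n}"
      "\<sigma>1 permutes {1..n}" by (rule columnsE)
    from cc(2) obtain p2 q2 \<sigma>2 where Y: "y = column_map n p2 q2 \<sigma>2" "p2 \<in> {1..n}" "q2 \<in> {1..n}"
      "\<sigma>2 permutes {1..n}" by (rule columnsE)
    have q1: "q1 = p2"
    proof (rule ccontr)
      assume "q1 \<noteq> p2"
      then have "fun_comp n x y \<in> consts_on n"
        by (simp add: X(1) Y(1) fun_comp_columns[OF X(2-4)] zero_const)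
      then show False using c columns_disjoint_consts[of n] n by auto
    qed
    then have eq: "column_map n p1 q2 (\<sigma>2 \<circ> \<sigma>1) = column_map n p q \<sigma>"
      using mult.prems(1) fun_comp_columns[OF X(2-4), of p2 q2 \<sigma>2] by (simp add: X(1) Y(1))
    have "p1 = p \<and> q2 = q \<and> \<sigma>2 \<circ> \<sigma>1 = \<sigma>"
      by (rule column_map_inj[OF eq X(2) permutes_compose[OF X(4) Y(4)] mult.prems(4)])
    then show ?case
      using mult.IH(1)[OF X] mult.IH(2)[OF Y] q1 path_trans by blast
  qed
  have path': "\<exists>m. path E m p q \<sigma>"
    if "p \<in> {1..n}" "q \<in> {1..n}" "\<sigma> permutes {1..n}" for p q \<sigma>
    by (rule path[OF _ refl that]) (use columnsI[OF that] in \<open>simp add: gen explicit_maps_def\<close>)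
  \<comment> \<open>Every vertex starts some path, hence has an outgoing edge; with at most
    \<open>n\<close> edges it has exactly one.\<close>
  have "{1..n} \<subseteq> fst ` E"
    using path' path_first_edge permutes_id by (metis subsetI)
  then have "n \<le> card (fst ` E)"
    using finE card_mono[of "fst ` E" "{1..n}"] by simp
  then have inj: "inj_on fst E"
    using cardE finE card_image_le[OF finE, of fst] by (intro eq_card_imp_inj_on) auto
  have comm: "\<sigma> \<circ> \<tau> = \<tau> \<circ> \<sigma>" if \<sigma>\<tau>: "\<sigma> permutes {1..n}" "\<tau> permutes {1..n}" for \<sigma> \<tau>
  proof -
    have 1: "1 \<in> {1..n}" using n by simp
    obtain a b where ab: "path E a 1 1 \<sigma>" "path E b 1 1 \<tau>" using path'[OF 1 1 \<sigma>\<tau>(1)] path'[OF 1 1 \<sigma>\<tau>(2)] by blast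
    \<comment> \<open>Traversing the two loops in either order uses the same number of edges from
      the same start.\<close>
    have "path E (Suc (a + b)) 1 1 (\<tau> \<circ> \<sigma>)" "path E (Suc (a + b)) 1 1 (\<sigma> \<circ> \<tau>)"
      using path_trans[OF ab] path_trans[OF ab(2,1)] by (simp_all add: add.commute)
    then show ?thesis using path_deterministic[OF inj] by blast
  qed
  \<comment> \<open>The third index is essential: the two sides send 3 to 1 and to 2.\<close>
  have "transpose 1 2 \<circ> transpose 2 (3::nat) = transpose 2 3 \<circ> transpose 1 (2::nat)"
    using n by (intro comm permutes_swap_id) auto
  from fun_cong[OF this, of 3] show False by (simp add: transpose_def)
qed

lemma card_generators_ge:
  assumes n: "n \<ge> 3" and U: "U \<subseteq> explicit_maps n"
    and gen: "generated (fun_comp n) U = explicit_maps n"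
  shows "card U \<ge> n + 3"
proof -
  have n2: "n \<ge> 2" using n by simp
  obtain a b where a: "a \<in> U" "a \<in> points n" and b: "b \<in> U" "b \<in> consts_on n"
    using generators_include_point[OF n2 U gen] generators_include_const[OF n2 U gen] by blast
  have finU: "finite U"
    using U A_plus_eq_explicit finite_A_plus finite_subset by metis
  have ne: "a \<noteq> b" "a \<notin> columns n" "b \<notin> columns n"
    using a b columns_disjoint_points[OF n2] points_disjoint_consts[OF n2]
      columns_disjoint_consts[OF n2] by auto
  have "n + 3 \<le> card (insert a (insert b (U \<inter> columns n)))"
    using generators_include_columns[OF n U gen] finU ne by simp
  also have "\<dots> \<le> card U" using a b finU by (intro card_mono) auto
  finally show ?thesis .
qed

section \<open>Upper bound: generators of the symmetric group and of the whole semigroup\<close>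

definition cycle :: "nat \<Rightarrow> nat \<Rightarrow> nat" where
  "cycle n i = (if i \<in> {1..<n} then Suc i else if i = n then 1 else i)"

lemma cycle_permutes:
  assumes "n \<ge> 1"
  shows "cycle n permutes {1..n}"
proof (rule bij_imp_permutes)
  have "cycle n ` {1..n} = {1..n}"
    using assms by (intro endo_inj_surj) (auto simp: cycle_def inj_on_def)
  moreover have "inj_on (cycle n) {1..n}"
    by (auto simp: cycle_def inj_on_def)
  ultimately show "bij_betw (cycle n) {1..n} {1..n}" by (simp add: bij_betw_def)
qed (use assms in \<open>auto simp: cycle_def\<close>)

lemma cycle_funpow_add: "1 \<le> i \<Longrightarrow> i + k \<le> n \<Longrightarrow> (cycle n ^^ k) i = i + k"
  by (induction k) (auto simp: cycle_def)

lemma cycle_funpow_n: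
  assumes "n \<ge> 1"
  shows "cycle n ^^ n = id"
proof
  fix i
  show "(cycle n ^^ n) i = id i"
  proof (cases "i \<in> {1..n}")
    case True
    \<comment> \<open>From \<open>i\<close> it takes \<open>n - i\<close> steps to reach
      \<open>n\<close>, one to wrap round to 1, and \<open>i - 1\<close> to return to
      \<open>i\<close>.\<close>
    have "n = (i - 1) + Suc (n - i)" using True by auto
    then have "(cycle n ^^ n) i = (cycle n ^^ (i - 1)) (cycle n ((cycle n ^^ (n - i)) i))"
      by (metis funpow_add comp_apply funpow.simps(2))
    also have "(cycle n ^^ (n - i)) i = n" using True cycle_funpow_add[of i "n - i" n] by auto
    also have "cycle n n = 1" by (simp add: cycle_def)
    also have "(cycle n ^^ (i - 1)) 1 = i" using True cycle_funpow_add[of 1 "i - 1" n] by auto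
    finally show ?thesis by simp
  next
    case False
    have "(cycle n ^^ k) i = i" for k
      using False assms by (induction k) (auto simp: cycle_def)
    then show ?thesis by simp
  qed
qed

text \<open>Conjugating \<open>transpose 1 2\<close> by powers of the cycle gives all adjacent
  transpositions, these give all transpositions, and these all permutations. Only closure under
  composition is assumed of \<open>H\<close>, so the power \<open>n - k\<close> stands for the
  inverse of the power \<open>k\<close>.\<close>

lemma cycle_transposition_generate:
  assumes n: "n \<ge> 2" and comp: "\<And>\<sigma> \<tau>. \<sigma> \<in> H \<Longrightarrow> \<tau> \<in> H \<Longrightarrow> \<sigma> \<circ> \<tau> \<in> H"
    and c: "cycle n \<in> H" and t: "transpose 1 2 \<in> H"
    and \<sigma>: "\<sigma> permutes {1..n}"
  shows "\<sigma> \<in> H"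
proof -
  have id_H: "id \<in> H" using comp[OF t t] by simp
  have pow: "cycle n ^^ k \<in> H" for k
  proof (induction k)
    case (Suc k)
    then show ?case using comp[OF c] by (simp only: funpow.simps)
  qed (use id_H in \<open>simp only: funpow.simps\<close>)
  have adj: "transpose (Suc k) (Suc (Suc k)) \<in> H" if k: "Suc (Suc k) \<le> n" for k
  proof -
    have bij: "bij (cycle n ^^ k)"
      using cycle_permutes[of n] n by (intro bij_fn) (auto dest: permutes_bij)
    have "transpose (Suc k) (Suc (Suc k)) \<circ> (cycle n ^^ k) = (cycle n ^^ k) \<circ> transpose 1 2"
    proof -
      have "inv (cycle n ^^ k) (Suc k) = 1" "inv (cycle n ^^ k) (Suc (Suc k)) = 2"
        using cycle_funpow_add[of 1 k n] cycle_funpow_add[of 2 k n] k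
        by (auto intro!: inv_f_eq[OF bij_is_inj[OF bij]])
      then show ?thesis
        using transpose_comp_eq[OF bij, of "Suc k" "Suc (Suc k)"] by (simp only:)
    qed
    then have "(cycle n ^^ k) \<circ> transpose 1 2 \<circ> (cycle n ^^ (n - k)) =
        transpose (Suc k) (Suc (Suc k)) \<circ> ((cycle n ^^ k) \<circ> (cycle n ^^ (n - k)))"
      by (simp only: o_assoc)
    also have "(cycle n ^^ k) \<circ> (cycle n ^^ (n - k)) = id"
      using cycle_funpow_n[of n] n k by (simp flip: funpow_add)
    finally show ?thesis using comp[OF comp[OF pow t] pow] by (metis comp_id)
  qed
  have tr: "transpose i (i + Suc d) \<in> H" if "1 \<le> i" "i + Suc d \<le> n" for i d
    using that
  proof (induction d)
    case 0
    then show ?case using adj[of "i - 1"] by simp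
  next
    case (Suc d)
    \<comment> \<open>Conjugation by \<open>?s\<close> moves the upper end of the transposition up
      by one.\<close>
    let ?s = "transpose (i + Suc d) (i + Suc (Suc d))"
    have "?s \<in> H" using adj[of "i + d"] Suc.prems by simp
    moreover have "transpose i (i + Suc d) \<in> H" using Suc by simp
    ultimately have "?s \<circ> transpose i (i + Suc d) \<circ> ?s \<in> H" using comp by blast
    also have "?s \<circ> transpose i (i + Suc d) \<circ> ?s = transpose i (i + Suc (Suc d))"
      by (auto simp: fun_eq_iff transpose_def)
    finally show ?case .
  qed
  have tr': "transpose a b \<in> H" if "a \<in> {1..n}" "b \<in> {1..n}" for a b
  proof -
    have less: "transpose a b \<in> H" if "a < b" "a \<in> {1..n}" "b \<in> {1..n}" for a b
      using tr[of a "b - Suc a"] that by simp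
    show ?thesis
      using less[of a b] less[of b a] that id_H
      by (cases a b rule: linorder_cases) (auto simp: transpose_commute)
  qed
  show ?thesis
    using finite_atLeastAtMost \<sigma>
  proof (induction rule: permutes_rev_induct)
    case id
    show ?case by (rule id_H)
  next
    case (swap a b p)
    then show ?case using tr' comp by blast
  qed
qed

text \<open>The edges out of \<open>1, ..., n\<close> form the circuit 1, 2, ..., \<open>n\<close>,
  1. Only its first edge has a nontrivial label, so one turn from 1 carries \<open>cycle n\<close>.
  A loop at 1 carries the transposition, which makes \<open>n + 1\<close> column maps.\<close>

definition generators :: "nat \<Rightarrow> (brandt \<Rightarrow> brandt) set" where
  "generators n =
    {column_map n 1 1 (transpose 1 2), column_map n 1 2 (cycle n),
      point_map n (Elt 1 1) (Elt 1 1), const_map n (Elt 1 1)} \<union>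
    (\<lambda>p. column_map n p (cycle n p) id) ` {2..n}"

text \<open>An upper bound suffices: \<open>card_generators_ge\<close> gives the other inequality,
  so the listed maps need not be shown distinct.\<close>

lemma card_generators_le: "n \<ge> 2 \<Longrightarrow> card (generators n) \<le> n + 3"
proof -
  assume n: "n \<ge> 2"
  have "card (generators n) \<le> card {column_map n 1 1 (transpose 1 2), column_map n 1 2 (cycle n),
      point_map n (Elt 1 1) (Elt 1 1), const_map n (Elt 1 1)} +
    card ((\<lambda>p. column_map n p (cycle n p) id) ` {2..n})"
    unfolding generators_def by (rule card_Un_le)
  also have "\<dots> \<le> 4 + (n - 1)"
    using card_image_le[of "{2..n}" "\<lambda>p. column_map n p (cycle n p) id"]
    by (intro add_mono) (auto simp: card_insert_if)
  finally show ?thesis using n by simp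
qed

lemma generators_subset: "n \<ge> 2 \<Longrightarrow> generators n \<subseteq> explicit_maps n"
  by (auto simp: generators_def explicit_maps_def brandt_iffs cycle_def
      intro!: columnsI pointsI consts_onI permutes_swap_id cycle_permutes permutes_id)

lemma generated_generators:
  assumes n: "n \<ge> 2"
  shows "generated (fun_comp n) (generators n) = explicit_maps n"
proof
  show "generated (fun_comp n) (generators n) \<subseteq> explicit_maps n"
    by (rule generated_subset[OF generators_subset[OF n] explicit_maps_comp])
next
  let ?G = "generated (fun_comp n) (generators n)"
  have in1: "1 \<in> {1..n}" "2 \<in> {1..n}" using n by auto
  have cyc: "cycle n permutes {1..n}" using cycle_permutes n by simp
  have comp: "column_map n p r (\<tau> \<circ> \<sigma>) \<in> ?G"
    if "column_map n p q \<sigma> \<in> ?G" "column_map n q r \<tau> \<in> ?G"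
      "p \<in> {1..n}" "q \<in> {1..n}" "\<sigma> permutes {1..n}" for p q r \<sigma> \<tau>
    using generated.mult[OF that(1,2)] fun_comp_columns[OF that(3-5), of q r \<tau>] by simp
  have edge: "column_map n p (cycle n p) id \<in> ?G" if "p \<in> {2..n}" for p
    using that by (intro generated.gen) (auto simp: generators_def)
  \<comment> \<open>Walks along the circuit from 1; all edges after the first have label
    \<open>id\<close>, so the label stays \<open>cycle n\<close>.\<close>
  have from1: "column_map n 1 q (cycle n) \<in> ?G" if "2 \<le> q" "q \<le> n" for q
    using that
  proof (induction q rule: dec_induct)
    case base
    show ?case by (intro generated.gen) (simp add: generators_def)
  next
    case (step q)
    have "cycle n q = Suc q" using step by (simp add: cycle_def)
    then show ?case
      using comp[OF step.IH, of "Suc q" id] edge[of q] step in1 cyc by simp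
  qed
  \<comment> \<open>Downward induction from \<open>n\<close>, whose edge leads back to 1.\<close>
  have to1: "column_map n p 1 id \<in> ?G" if "p \<le> n" "2 \<le> p" for p
    using that
  proof (induction rule: inc_induct)
    case base
    then show ?case using edge[of n] by (simp add: cycle_def id_def)
  next
    case (step p)
    have "cycle n p = Suc p" using step by (simp add: cycle_def)
    then show ?case
      using comp[OF _ step.IH, of p id] edge[of p] step by (simp add: permutes_id)
  qed
  have loops: "column_map n 1 1 \<sigma> \<in> ?G" if "\<sigma> permutes {1..n}" for \<sigma>
  proof -
    have "\<sigma> \<in> {\<sigma>. \<sigma> permutes {1..n} \<and> column_map n 1 1 \<sigma> \<in> ?G}" (is "_ \<in> ?H")
    proof (rule cycle_transposition_generate[OF n _ _ _ that])
      show "\<sigma> \<circ> \<tau> \<in> ?H" if "\<sigma> \<in> ?H" "\<tau> \<in> ?H" for \<sigma> \<tau>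
        using that comp[of 1 1 \<tau> 1 \<sigma>] in1 by (auto intro: permutes_compose)
      \<comment> \<open>One full turn: the edge from 1 to 2, then the rest of the circuit.\<close>
      show "cycle n \<in> ?H"
        using comp[OF from1[of 2] to1[of 2]] n in1 cyc by simp
      show "transpose 1 2 \<in> ?H"
        using in1 by (auto simp: generators_def intro: generated.gen permutes_swap_id)
    qed
    then show ?thesis by simp
  qed
  have row: "column_map n 1 q \<sigma> \<in> ?G" if "q \<in> {1..n}" "\<sigma> permutes {1..n}" for q \<sigma>
  proof (cases "q = 1")
    case False
    \<comment> \<open>A preliminary loop at 1 with this label cancels the \<open>cycle n\<close>
      picked up on the way to \<open>q\<close>.\<close>
    have i: "inv (cycle n) \<circ> \<sigma> permutes {1..n}"
      using permutes_compose[OF that(2) permutes_inv[OF cyc]] .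
    have "column_map n 1 q (cycle n \<circ> (inv (cycle n) \<circ> \<sigma>)) \<in> ?G"
      using False that(1) in1 i by (intro comp[OF loops[OF i] from1]) auto
    then show ?thesis by (simp add: o_assoc permutes_inv_o[OF cyc])
  qed (use loops that in simp)
  have col: "column_map n p q \<sigma> \<in> ?G"
    if "p \<in> {1..n}" "q \<in> {1..n}" "\<sigma> permutes {1..n}" for p q \<sigma>
  proof (cases "p = 1")
    case False
    then show ?thesis
      using comp[OF to1[of p] row[of q \<sigma>]] that in1 by (simp add: permutes_id)
  qed (use row that in simp)
  have point: "point_map n (Elt k l) (Elt p q) \<in> ?G"
    if kl: "k \<in> {1..n}" "l \<in> {1..n}" "p \<in> {1..n}" "q \<in> {1..n}" for k l p q
  proof -
    have s: "transpose k 1 permutes {1..n}" "transpose 1 p permutes {1..n}"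
      using kl in1 by (auto intro: permutes_swap_id)
    \<comment> \<open>The left column map pulls the support \<open>Elt 1 1\<close> back to
      \<open>Elt k l\<close>; the right one carries the value \<open>Elt 1 1\<close> to
      \<open>Elt p q\<close>.\<close>
    have "fun_comp n (fun_comp n (column_map n l 1 (transpose k 1)) (point_map n (Elt 1 1) (Elt 1 1)))
        (column_map n 1 q (transpose 1 p)) \<in> ?G"
      using kl in1 s
      by (intro generated.mult col) (auto intro: generated.gen simp: generators_def)
    then show ?thesis
      using kl in1 s
      by (simp add: fun_comp_column_point fun_comp_point_left brandt_iffs)
  qed
  have const: "const_map n c \<in> ?G" if c: "c \<in> brandt n" for c
  proof (cases c)
    case Theta
    \<comment> \<open>The middle indices 1 and 2 differ, so the product vanishes.\<close>
    have "fun_comp n (column_map n 1 1 id) (column_map n 2 2 id) \<in> ?G"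
      using in1 by (intro generated.mult col permutes_id)
    then show ?thesis using fun_comp_columns[OF in1(1,1) permutes_id, of 2 2 id] Theta by simp
  next
    case (Elt p q)
    then have pq: "p \<in> {1..n}" "q \<in> {1..n}" using c by (simp_all add: brandt_iffs)
    have "fun_comp n (const_map n (Elt 1 1)) (column_map n 1 q (transpose 1 p)) \<in> ?G"
      using pq in1
      by (intro generated.mult col permutes_swap_id)
        (auto intro: generated.gen simp: generators_def)
    then show ?thesis using in1 by (simp add: Elt fun_comp_const_left brandt_iffs)
  qed
  show "explicit_maps n \<subseteq> ?G"
    using col point const by (intro explicit_maps_subsetI)
qed

theorem theorem3p5:
  fixes n :: nat
  assumes "n \<ge> 3"
  shows "lower_rank (A_plus n) (fun_comp n) = n + 3"
proof -
  let ?R = "{card U | U. U \<subseteq> explicit_maps n \<and> generated (fun_comp n) U = explicit_maps n}"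
  have n2: "n \<ge> 2" using assms by simp
  have fin: "finite (explicit_maps n)" using finite_A_plus A_plus_eq_explicit by metis
  \<comment> \<open>Bounds the possible sizes, so that the minimum is taken over a finite
    set.\<close>
  have "?R \<subseteq> {..card (explicit_maps n)}" using fin by (auto intro: card_mono)
  then have "finite ?R" by (rule finite_subset) simp
  moreover have "n + 3 \<le> r" if "r \<in> ?R" for r using that card_generators_ge[OF assms] by blast
  moreover have "card (generators n) = n + 3"
    using card_generators_le[OF n2]
      card_generators_ge[OF assms generators_subset[OF n2] generated_generators[OF n2]] by simp
  then have "n + 3 \<in> ?R"
    using generators_subset[OF n2] generated_generators[OF n2]
    by (intro CollectI exI[of _ "generators n"]) simp
  ultimately have "Min ?R = n + 3" by (intro Min_eqI)
  then show ?thesis by (simp add: lower_rank_def A_plus_eq_explicit)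
qed

end
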